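(* Let $A$ be an invertible $2\times 2$ matrix over $\mathbb F_2$. If $A$ admits a diagonal form over $\mathbb F_2$, then $A$ is a square over $\mathbb F_2$, i.e. there is a matrix $B\in GL_2(\mathbb F_2)$ with $B^2=A$.
   Context: A matrix admits a diagonal form over a field if it is similar over that field to a diagonal matrix. Matrices in this setting are elements of $GL_2(\mathbb F_2)=SL_2(\mathbb F_2)$. *)

theory Defs
  imports "Jordan_Normal_Form.Matrix" "HOL-Library.Z2"
begin

(* The field of definition is the entry type: the diagonal matrix and the
   conjugating matrix both have entries in 'a. *)
definition admits_diagonal_form :: "'a :: field mat \<Rightarrow> bool" where
  "admits_diagonal_form A \<longleftrightarrow> (\<exists>D. similar_mat A D \<and> diagonal_mat D)"

definition GL :: "nat \<Rightarrow> 'a :: field mat set" where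
  "GL n = {A \<in> carrier_mat n n. invertible_mat A}"

end

theory Submission
  imports Defs "Jordan_Normal_Form.Determinant"
begin

text \<open>
  The reason is that the only nonzero element of $\mathbb F_2$ is $1$. The determinant of a
  diagonal matrix is the product of its diagonal entries and is a similarity invariant, so a
  diagonal form of an invertible matrix has no zero on its diagonal. Over $\mathbb F_2$ the
  diagonal form must therefore be the identity, which is similar only to itself. Hence an
  invertible diagonalizable matrix over $\mathbb F_2$ of any size is the identity
  (lemma \<open>GL_bit_diagonalizable_eq_one\<close>), which is its own square.
\<close>

lemma det_nonzero_if_GL:
  assumes "A \<in> GL n"
  shows "det A \<noteq> 0"
proof -
  from assms obtain B where A: "A \<in> carrier_mat n n"
    and AB: "A * B = 1\<^sub>m n" and BA: "B * A = 1\<^sub>m (dim_row B)"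
    unfolding GL_def invertible_mat_def inverts_mat_def by auto
  \<comment> \<open>Invertibility does not fix the shape of the inverse; the two product equations do.\<close>
  have "dim_col B = n" "dim_row B = n"
    using arg_cong[OF AB, of dim_col] arg_cong[OF BA, of dim_col] A by auto
  then have B: "B \<in> carrier_mat n n" by auto
  have "det A * det B = 1"
    using arg_cong[OF AB, of det] det_mult[OF A B] by simp
  then show ?thesis by auto
qed

lemma one_mat_in_GL: "1\<^sub>m n \<in> GL n"
  unfolding GL_def invertible_mat_def inverts_mat_def square_mat.simps
  by (auto intro!: exI[of _ "1\<^sub>m n"])

lemma diagonal_entry_nonzero_if_det_nonzero:
  fixes D :: "'a :: field mat"
  assumes D: "D \<in> carrier_mat n n" and diag: "diagonal_mat D"
    and det: "det D \<noteq> 0" and i: "i < n"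
  shows "D $$ (i, i) \<noteq> 0"
proof -
  have "upper_triangular D"
    using D diag unfolding diagonal_mat_def by (auto intro!: upper_triangularI)
  then have "prod_list (diag_mat D) \<noteq> 0"
    using det det_upper_triangular D by metis
  moreover have "D $$ (i, i) \<in> set (diag_mat D)"
    using D i unfolding diag_mat_def by auto
  ultimately show ?thesis by (metis prod_list_zero_iff)
qed

lemma similar_one_mat_imp_eq:
  assumes "similar_mat A (1\<^sub>m n)"
  shows "A = 1\<^sub>m n"
proof -
  from similar_matD[OF assms] obtain m P Q where
    carr: "{A, 1\<^sub>m n, P, Q} \<subseteq> carrier_mat m m"
    and PQ: "P * Q = 1\<^sub>m m" and A: "A = P * 1\<^sub>m n * Q" by blast
  have "m = n" using carr by auto
  moreover have "P * 1\<^sub>m m = P" using carr by (intro right_mult_one_mat[of _ m]) blast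
  ultimately show ?thesis using PQ unfolding A by simp
qed

text \<open>
  Being the identity is special to $\mathbb F_2$: over any larger field, a scalar matrix of
  positive size with scalar other than $0$ and $1$ is invertible and diagonal.
\<close>

lemma GL_bit_diagonalizable_eq_one:
  fixes A :: "bit mat"
  assumes GL: "A \<in> GL n" and "admits_diagonal_form A"
  shows "A = 1\<^sub>m n"
proof -
  from assms obtain D where sim: "similar_mat A D" and diag: "diagonal_mat D"
    unfolding admits_diagonal_form_def by auto
  have D: "D \<in> carrier_mat n n"
    using similar_matD[OF sim] GL unfolding GL_def by auto
  have "det D \<noteq> 0"
    using det_nonzero_if_GL[OF GL] det_similar[OF sim] by simp
  then have "D $$ (i, i) = 1" if "i < n" for i
    using diagonal_entry_nonzero_if_det_nonzero[OF D diag _ that] by (simp add: bit_not_zero_iff)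
  then have "D = 1\<^sub>m n"
    using D diag unfolding diagonal_mat_def by (intro eq_matI) auto
  with sim show ?thesis using similar_one_mat_imp_eq by simp
qed

theorem corollary21:
  fixes A :: "bit mat"
  assumes "A \<in> GL 2"
    and "admits_diagonal_form A"
  shows "\<exists>B \<in> GL 2. B ^\<^sub>m 2 = A"
proof
  show "1\<^sub>m 2 \<in> GL 2" by (rule one_mat_in_GL)
  show "1\<^sub>m 2 ^\<^sub>m 2 = A"
    using GL_bit_diagonalizable_eq_one[OF assms] by (simp add: numeral_2_eq_2)
qed

end
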